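(* Let $\mathcal{I}$ be a finite index set partitioned into disjoint groups $\mathcal{I}_1,\dots,\mathcal{I}_K$. For each $k\in\{1,\dots,K\}$ let $p_k\in[-\infty,1)$ and let weights $w^k=(w_i)_{i\in\mathcal{I}_k}$ be given with $w_i>0$ and $\sum_{i\in\mathcal{I}_k}w_i=1$. Let $A=(A_i)_{i\in\mathcal{I}}$ be a tuple of nonzero real symmetric positive semidefinite $n\times n$ matrices. Put $q_k=p_k(p_k-1)^{-1}$ (with $q_k=1$ if $p_k=-\infty$), and define $\mathcal{A}=\prod_{k=1}^K\mathcal{A}_k$, where $$\mathcal{A}_k=\Bigl\{\alpha\in\mathbb{R}_{\ge 0}^{|\mathcal{I}_k|}\;\Bigm|\;\operatorname{Mean}_{q_k,w^k}[\alpha]=1\Bigr\}\ \text{ if } p_k<0,\qquad \mathcal{A}_k=\Bigl\{\alpha\in\mathbb{R}_{>0}^{|\mathcal{I}_k|}\;\Bigm|\;\operatorname{Mean}_{q_k,w^k}[\alpha]=1\Bigr\}\ \text{ if } 0\le p_k<1.$$ For $x\in\mathbb{R}^n$ let $S(x)=\sum_{k=1}^K\operatorname{Mean}_{p_k,w^k}\bigl[(x^\top A_i x)_{i\in\mathcal{I}_k}\bigr]$. Then: (i) Unconditionally, $\displaystyle\inf_{\|x\|=1}S(x)=\inf_{\alpha\in\mathcal{A}}\lambda_{\min}\Bigl(\sum_{i\in\mathcal{I}}\alpha_i w_i A_i\Bigr)$. (ii) If the lower envelope $V_{A,I}$ (with $I$ the $n\times n$ identity matrix) is convex, then $\displaystyle\sup_{\|x\|=1}S(x)=\inf_{\alpha\in\mathcal{A}}\lambda_{\max}\Bigl(\sum_{i\in\mathcal{I}}\alpha_i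 w_i A_i\Bigr)$.
   Context: Weighted power means: for $y\in\mathbb{R}^m_{\ge 0}$, weights $w\in\mathbb{R}^m_{>0}$ with $\sum_i w_i=1$, and real $p\ne 0$, $\operatorname{Mean}_{p,w}[y]=\bigl(\sum_{i=1}^m w_i y_i^p\bigr)^{1/p}$, with the convention that $\operatorname{Mean}_{p,w}[y]=0$ if $p<0$ and some $y_i=0$. In the limiting cases, $\operatorname{Mean}_{0,w}[y]=\prod_{i=1}^m y_i^{w_i}$, $\operatorname{Mean}_{-\infty,w}[y]=\min_i y_i$ and $\operatorname{Mean}_{+\infty,w}[y]=\max_i y_i$. Lower envelope: for a tuple $A=(A_i)_{i\in\mathcal{I}}$ of real symmetric $n\times n$ matrices and a symmetric positive semidefinite $n\times n$ matrix $B$, $V_{A,B}:\mathbb{R}^{|\mathcal{I}|}\to\mathbb{R}\cup\{+\infty\}$ is defined by $$V_{A,B}(a)=\inf\bigl\{x^\top Bx\;\big|\;x\in\mathbb{R}^n,\ x^\top A_i x=a_i\ \text{for all } i\in\mathcal{I}\bigr\},\qquad \inf\varnothing=+\infty.$$ Convexity of $V_{A,B}$ is meant in the extended-real-valued sense. $\lambda_{\min},\lambda_{\max}$ denote the smallest and largest eigenvalues of a symmetric matrix, and $\|\cdot\|$ is the Euclidean norm. *)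

theory Defs
  imports "HOL-Analysis.Analysis"
begin

definition quad_form :: "real^'n^'n \<Rightarrow> real^'n \<Rightarrow> real" where
  "quad_form M x = x \<bullet> (M *v x)"

definition sym_matrix :: "real^'n^'n \<Rightarrow> bool" where
  "sym_matrix M \<longleftrightarrow> transpose M = M"

definition psd_matrix :: "real^'n^'n \<Rightarrow> bool" where
  "psd_matrix M \<longleftrightarrow> sym_matrix M \<and> (\<forall>x. 0 \<le> quad_form M x)"

definition eigenvalues :: "real^'n^'n \<Rightarrow> real set" where
  "eigenvalues M = {\<mu>. \<exists>v. v \<noteq> 0 \<and> M *v v = \<mu> *\<^sub>R v}"

text \<open>Meant for symmetric matrices, whose set of real eigenvalues is finite and nonempty.\<close>

definition lambda_min :: "real^'n^'n \<Rightarrow> real" where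
  "lambda_min M = Min (eigenvalues M)"

definition lambda_max :: "real^'n^'n \<Rightarrow> real" where
  "lambda_max M = Max (eigenvalues M)"

text \<open>Weighted power mean of the nonnegative entries \<open>y i\<close>, \<open>i \<in> J\<close>, for a finite
  nonempty \<open>J\<close> and positive weights that sum to 1 over \<open>J\<close>. For real exponents note that
  \<open>0 powr r = 0\<close> for every \<open>r\<close>, so the convention for negative exponents and a zero
  entry has to be a separate case.\<close>

definition power_mean :: "ereal \<Rightarrow> ('i \<Rightarrow> real) \<Rightarrow> 'i set \<Rightarrow> ('i \<Rightarrow> real) \<Rightarrow> real" where
  "power_mean p w J y =
    (if p = -\<infinity> then Min (y ` J)
     else if p = \<infinity> then Max (y ` J)
     else if p = 0 then (\<Prod>i\<in>J. y i powr w i)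
     else if p < 0 \<and> (\<exists>i\<in>J. y i = 0) then 0
     else (\<Sum>i\<in>J. w i * y i powr real_of_ereal p) powr (1 / real_of_ereal p))"

definition dual_exponent :: "ereal \<Rightarrow> ereal" where
  "dual_exponent p =
    (if p = -\<infinity> then 1 else ereal (real_of_ereal p * inverse (real_of_ereal p - 1)))"

text \<open>The set for a single group \<open>J\<close> is a set of vectors indexed by \<open>J\<close>. It is represented by
  the cylinder of all vectors over the full index type whose coordinates in \<open>J\<close> satisfy
  its defining conditions; for groups that partition the index type, the Cartesian product of
  the sets is then the intersection of the cylinders.\<close>

definition multiplier_cyl :: "ereal \<Rightarrow> ('i \<Rightarrow> real) \<Rightarrow> 'i set \<Rightarrow> (real^'i) set" where
  "multiplier_cyl p w J =
    {\<alpha>. (if p < 0 then \<forall>i\<in>J. 0 \<le> \<alpha> $ i else \<forall>i\<in>J. 0 < \<alpha> $ i) \<and>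
         power_mean (dual_exponent p) w J (\<lambda>i. \<alpha> $ i) = 1}"

definition multipliers ::
    "nat \<Rightarrow> (nat \<Rightarrow> 'i set) \<Rightarrow> (nat \<Rightarrow> ereal) \<Rightarrow> ('i \<Rightarrow> real) \<Rightarrow> (real^'i) set" where
  "multipliers K G p w = (\<Inter>k\<in>{1..K}. multiplier_cyl (p k) w (G k))"

definition mean_sum ::
    "nat \<Rightarrow> (nat \<Rightarrow> 'i set) \<Rightarrow> (nat \<Rightarrow> ereal) \<Rightarrow> ('i \<Rightarrow> real) \<Rightarrow> ('i \<Rightarrow> real^'n^'n)
      \<Rightarrow> real^'n \<Rightarrow> real" where
  "mean_sum K G p w A x = (\<Sum>k=1..K. power_mean (p k) w (G k) (\<lambda>i. quad_form (A i) x))"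

definition weighted_matrix ::
    "('i::finite \<Rightarrow> real) \<Rightarrow> ('i \<Rightarrow> real^'n^'n) \<Rightarrow> real^'i \<Rightarrow> real^'n^'n" where
  "weighted_matrix w A \<alpha> = (\<Sum>i\<in>UNIV. (\<alpha> $ i * w i) *\<^sub>R A i)"

text \<open>The infimum is taken in \<open>ereal\<close>, so it is \<open>\<infinity>\<close> on the empty set.\<close>

definition lower_envelope ::
    "('i \<Rightarrow> real^'n^'n) \<Rightarrow> real^'n^'n \<Rightarrow> real^'i \<Rightarrow> ereal" where
  "lower_envelope A B a =
    (INF x\<in>{x. \<forall>i. quad_form (A i) x = a $ i}. ereal (quad_form B x))"

text \<open>Intended for functions that do not take the value \<open>-\<infinity>\<close>.\<close>

definition ext_convex :: "('a::real_vector \<Rightarrow> ereal) \<Rightarrow> bool" where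
  "ext_convex f \<longleftrightarrow> (\<forall>a b t. 0 < t \<and> t < 1 \<longrightarrow>
     f ((1 - t) *\<^sub>R a + t *\<^sub>R b) \<le> ereal (1 - t) * f a + ereal t * f b)"

end

(*
For p < 1 the power mean is an infimum of linear functionals: the reverse Hoelder inequality says
Mean_p[y] <= sum_i w_i alpha_i y_i whenever Mean_q[alpha] = 1, and the infimum over such alpha is
Mean_p[y]. Hence S(x) is the infimum over the multipliers of the Rayleigh quotients of
M(alpha) = sum_i alpha_i w_i A_i, and (i) is an interchange of two infima.

For (ii), convexity of V makes its sublevel set P = {(x^T A_i x)_i : |x| <= 1} convex; it is also
compact. If s exceeds the supremum of S, then P is disjoint from the closed convex set Q of the
v >= 0 whose pairing with every multiplier is at least s. A separating functional can be perturbed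
to have positive coefficients; testing it on the equality cases of the reverse Hoelder inequality,
one group at a time, shows that after rescaling it dominates a multiplier alpha with
lambda_max(M(alpha)) <= s.
*)
theory Submission imports Defs begin

section \<open>Power means with exponent below 1: reverse Hoelder inequality, equality cases,
  near-optimal multipliers\<close>

section \<open>Weighted power means\<close>

text \<open>Weighted AM-GM with weights \<open>p\<close> and \<open>1 - p\<close>, applied to
  \<open>u * v\<close> and \<open>v powr q\<close> where \<open>q = p / (p - 1)\<close>. Since
  \<open>q * (1 - p) = - p\<close>, the powers of \<open>v\<close> cancel and
  \<open>u powr p\<close> is left.\<close>

lemma reverse_young:
  fixes p :: real
  assumes "0 < p" "p < 1" "0 \<le> u" "0 < v"
  shows "u powr p / p + v powr (p / (p - 1)) / (p / (p - 1)) \<le> u * v"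
proof (cases "u = 0")
  case True
  then show ?thesis using assms by (simp add: mult_nonneg_nonpos divide_nonpos_pos)
next
  case False
  let ?q = "p / (p - 1)"
  have "(u * v) powr p * (v powr ?q) powr (1 - p) \<le> p * (u * v) + (1 - p) * v powr ?q"
    using assms False by (intro Youngs_inequality_0) auto
  moreover have "?q * (1 - p) = - p" using assms by (simp add: field_simps)
  then have "(u * v) powr p * (v powr ?q) powr (1 - p) = u powr p"
    using assms by (simp add: powr_mult powr_powr powr_minus)
  ultimately show ?thesis using assms by (simp add: field_simps)
qed

lemma dual_exponent_minf: "dual_exponent (-\<infinity>) = 1"
  by (simp add: dual_exponent_def)

lemma dual_exponent_real: "dual_exponent (ereal r) = ereal (r / (r - 1))"
  by (simp add: dual_exponent_def divide_inverse)

lemma dual_exponent_zero: "dual_exponent 0 = 0"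
  using dual_exponent_real[of 0] by (simp add: zero_ereal_def)

text \<open>Lets a vector and a multiplier exchange roles. Only finite exponents are covered:
  \<open>-\<infinity>\<close> is sent to 1, and 1 is sent to 0 because
  \<open>inverse 0 = 0\<close>.\<close>

lemma dual_exponent_involution:
  assumes "r < 1"
  shows "dual_exponent (dual_exponent (ereal r)) = ereal r"
proof -
  have "r / (r - 1) / (r / (r - 1) - 1) = r" using assms by (auto simp: field_simps)
  then show ?thesis by (simp add: dual_exponent_real)
qed

lemma power_mean_cong:
  assumes "\<And>i. i \<in> J \<Longrightarrow> y i = z i"
  shows "power_mean p w J y = power_mean p w J z"
proof -
  have "y ` J = z ` J" using assms by (rule image_cong[OF refl])
  moreover have "(\<exists>i\<in>J. y i = 0) \<longleftrightarrow> (\<exists>i\<in>J. z i = 0)" using assms by auto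
  moreover have "(\<Prod>i\<in>J. y i powr w i) = (\<Prod>i\<in>J. z i powr w i)"
    using assms by (intro prod.cong) auto
  moreover have "(\<Sum>i\<in>J. w i * y i powr r) = (\<Sum>i\<in>J. w i * z i powr r)" for r
    using assms by (intro sum.cong) auto
  ultimately show ?thesis by (simp only: power_mean_def)
qed

locale prob_weights =
  fixes J :: "'i set" and w :: "'i \<Rightarrow> real"
  assumes finite_J: "finite J"
    and w_pos: "\<And>i. i \<in> J \<Longrightarrow> 0 < w i"
    and w_sum: "(\<Sum>i\<in>J. w i) = 1"
begin

lemma J_nonempty: "J \<noteq> {}"
  using w_sum by auto

lemma weighted_sum_pos: "0 < (\<Sum>i\<in>J. w i * f i)" if "\<And>i. i \<in> J \<Longrightarrow> 0 < f i"
  using finite_J J_nonempty w_pos that by (intro sum_pos) auto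

lemma weighted_sum_nonneg: "0 \<le> (\<Sum>i\<in>J. w i * f i)" if "\<And>i. i \<in> J \<Longrightarrow> 0 \<le> f i"
  using w_pos that by (intro sum_nonneg mult_nonneg_nonneg) (auto simp: less_imp_le)

lemma power_mean_real:
  assumes "p \<noteq> 0" "p > 0 \<or> (\<forall>i\<in>J. y i \<noteq> 0)"
  shows "power_mean (ereal p) w J y = (\<Sum>i\<in>J. w i * y i powr p) powr (1 / p)"
  using assms by (auto simp: power_mean_def zero_ereal_def)

lemma power_mean_zero: "power_mean 0 w J y = (\<Prod>i\<in>J. y i powr w i)"
  by (simp add: power_mean_def)

lemma power_mean_minf: "power_mean (-\<infinity>) w J y = Min (y ` J)"
  by (simp add: power_mean_def)

lemma power_mean_one: "power_mean 1 w J y = (\<Sum>i\<in>J. w i * y i)" if "\<And>i. i \<in> J \<Longrightarrow> 0 \<le> y i"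
  using power_mean_real[of 1 y] that weighted_sum_nonneg[of y]
  by (simp add: one_ereal_def)

lemma power_mean_nonneg: "0 \<le> power_mean p w J y" if "\<And>i. i \<in> J \<Longrightarrow> 0 \<le> y i"
proof -
  obtain j where "j \<in> J" using J_nonempty by auto
  then have "0 \<le> Max (y ` J)"
    using that finite_J by (meson Max_ge finite_imageI imageI order_trans)
  then show ?thesis
    using that finite_J J_nonempty by (auto simp: power_mean_def intro!: prod_nonneg)
qed

lemma power_mean_pos:
  assumes "\<And>i. i \<in> J \<Longrightarrow> 0 < y i"
  shows "0 < power_mean p w J y"
proof -
  obtain j where j: "j \<in> J" using J_nonempty by auto
  then have "0 < Max (y ` J)"
    using assms finite_J by (meson Max_ge finite_imageI imageI order_less_le_trans)
  moreover have "(\<Sum>i\<in>J. w i * y i powr r) \<noteq> 0" for r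
    using weighted_sum_pos[of "\<lambda>i. y i powr r"] assms by (auto simp: order_less_imp_not_eq2)
  moreover have "0 < (\<Prod>i\<in>J. y i powr w i)"
    using assms by (intro prod_pos) force
  moreover have "0 < Min (y ` J)"
    using assms finite_J J_nonempty by simp
  moreover have "\<not> (\<exists>i\<in>J. y i = 0)" using assms by force
  ultimately show ?thesis
    by (simp add: power_mean_def)
qed

lemma power_mean_const_1:
  assumes "\<And>i. i \<in> J \<Longrightarrow> y i = 1"
  shows "power_mean p w J y = 1"
proof -
  have "y ` J = {1}" using assms J_nonempty by auto
  then show ?thesis using assms w_sum by (auto simp: power_mean_def)
qed

text \<open>Homogeneity is what normalises a positive vector to mean 1; multipliers and equality
  cases are both produced by such a rescaling.\<close>

lemma power_mean_scale:
  assumes c: "0 < c" and y: "\<And>i. i \<in> J \<Longrightarrow> 0 \<le> y i"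
  shows "power_mean p w J (\<lambda>i. c * y i) = c * power_mean p w J y"
proof -
  have mono: "mono ((*) c)" using c by (auto intro!: monoI mult_left_mono)
  have im: "(\<lambda>i. c * y i) ` J = (*) c ` (y ` J)" by auto
  have m: "Min ((\<lambda>i. c * y i) ` J) = c * Min (y ` J)" "Max ((\<lambda>i. c * y i) ` J) = c * Max (y ` J)"
    unfolding im using finite_J J_nonempty
    by (simp_all add: mono_Min_commute[OF mono] mono_Max_commute[OF mono])
  have p: "(\<Prod>i\<in>J. (c * y i) powr w i) = c * (\<Prod>i\<in>J. y i powr w i)"
  proof -
    have "(\<Prod>i\<in>J. (c * y i) powr w i) = (\<Prod>i\<in>J. c powr w i) * (\<Prod>i\<in>J. y i powr w i)"
      using c y by (simp add: powr_mult prod.distrib)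
    also have "(\<Prod>i\<in>J. c powr w i) = c powr (\<Sum>i\<in>J. w i)"
      using c by (simp add: powr_sum finite_J)
    finally show ?thesis using c w_sum by simp
  qed
  have s: "(\<Sum>i\<in>J. w i * (c * y i) powr r) powr (1 / r) = c * (\<Sum>i\<in>J. w i * y i powr r) powr (1 / r)"
    if "r \<noteq> 0" for r
  proof -
    have "(\<Sum>i\<in>J. w i * (c * y i) powr r) = c powr r * (\<Sum>i\<in>J. w i * y i powr r)"
      using c y by (simp add: powr_mult sum_distrib_left mult_ac)
    then show ?thesis
      using c that by (simp add: powr_mult powr_powr weighted_sum_nonneg)
  qed
  have r: "real_of_ereal p \<noteq> 0" if "p \<noteq> -\<infinity>" "p \<noteq> \<infinity>" "p \<noteq> 0"
    using that by (simp add: real_of_ereal_eq_0)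
  show ?thesis
    using c r by (auto simp: power_mean_def m p s)
qed

text \<open>Concavity of \<open>ln\<close> (Jensen), exponentiated. A zero entry has to be split
  off, but then the product vanishes.\<close>

lemma weighted_arith_geom:
  assumes "\<And>i. i \<in> J \<Longrightarrow> 0 \<le> z i"
  shows "(\<Prod>i\<in>J. z i powr w i) \<le> (\<Sum>i\<in>J. w i * z i)"
proof (cases "\<exists>i\<in>J. z i = 0")
  case True
  then have "(\<Prod>i\<in>J. z i powr w i) = 0"
    using finite_J by (auto intro!: prod_zero)
  then show ?thesis using weighted_sum_nonneg[of z] assms by simp
next
  case False
  then have pos: "0 < z i" if "i \<in> J" for i using assms[OF that] that by force
  have S: "0 < (\<Sum>i\<in>J. w i * z i)" using pos by (rule weighted_sum_pos)
  have "(\<Sum>i\<in>J. w i * ln (z i)) \<le> ln (\<Sum>i\<in>J. w i *\<^sub>R z i)"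
    using concave_on_sum[OF finite_J J_nonempty ln_concave w_sum, of z] pos w_pos
    by (auto simp: less_imp_le)
  then have "exp (\<Sum>i\<in>J. w i * ln (z i)) \<le> (\<Sum>i\<in>J. w i * z i)"
    using S by (simp add: ln_ge_iff)
  moreover have "exp (\<Sum>i\<in>J. w i * ln (z i)) = (\<Prod>i\<in>J. z i powr w i)"
    using pos by (simp add: exp_sum finite_J powr_def order_less_imp_not_eq2)
  ultimately show ?thesis by simp
qed

text \<open>Divide \<open>y\<close> by its mean \<open>M\<close> and \<open>a\<close> by its mean
  \<open>N\<close>, then average the reverse Young inequality with the weights \<open>w\<close>. The
  left sides add up to 1/p + 1/q = 1.\<close>

lemma reverse_holder_pos:
  fixes p :: real
  assumes p: "0 < p" "p < 1" and y: "\<And>i. i \<in> J \<Longrightarrow> 0 \<le> y i" and a: "\<And>i. i \<in> J \<Longrightarrow> 0 < a i"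
  shows "power_mean p w J y * power_mean (p / (p - 1)) w J a \<le> (\<Sum>i\<in>J. w i * (a i * y i))"
proof -
  define q where "q = p / (p - 1)"
  have q: "q < 0" "1 / p + 1 / q = 1" using p by (auto simp: q_def field_simps)
  define M where "M = power_mean p w J y"
  define N where "N = power_mean q w J a"
  have M0: "0 \<le> M" unfolding M_def using y by (rule power_mean_nonneg)
  have N0: "0 < N" unfolding N_def using a by (rule power_mean_pos)
  have Neq: "N = (\<Sum>i\<in>J. w i * a i powr q) powr (1 / q)"
    unfolding N_def using q a by (intro power_mean_real) force+
  have Meq: "M = (\<Sum>i\<in>J. w i * y i powr p) powr (1 / p)"
    unfolding M_def using p by (intro power_mean_real) auto
  show ?thesis
  proof (cases "M = 0")
    case True
    then show ?thesis using weighted_sum_nonneg[of "\<lambda>i. a i * y i"] y a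
      by (simp add: M_def less_imp_le)
  next
    case False
    then have M1: "0 < M" using M0 by simp
    have Mp: "M powr p = (\<Sum>i\<in>J. w i * y i powr p)"
      using p by (simp add: Meq powr_powr weighted_sum_nonneg)
    have Nq: "N powr q = (\<Sum>i\<in>J. w i * a i powr q)"
      using q by (simp add: Neq powr_powr weighted_sum_nonneg)
    have "1 = (M powr p / M powr p) / p + (N powr q / N powr q) / q"
      using M1 N0 q by simp
    also have "\<dots> = (\<Sum>i\<in>J. w i * ((y i / M) powr p / p + (a i / N) powr q / q))"
    proof -
      have e: "w i * ((y i / M) powr p / p + (a i / N) powr q / q) =
        (w i * y i powr p) * (1 / (M powr p * p)) + (w i * a i powr q) * (1 / (N powr q * q))"
        if "i \<in> J" for i
        using y[OF that] a[OF that] M1 N0 by (simp add: powr_divide field_simps)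
      show ?thesis
        by (simp only: sum.cong[OF refl e] sum.distrib flip: sum_distrib_right Mp Nq) simp
    qed
    also have "\<dots> \<le> (\<Sum>i\<in>J. w i * ((y i / M) * (a i / N)))"
      using y a w_pos M1 N0 p unfolding q_def
      by (intro sum_mono mult_left_mono reverse_young) (auto simp: less_imp_le)
    also have "\<dots> = (\<Sum>i\<in>J. w i * (a i * y i)) / (M * N)"
      by (simp add: sum_divide_distrib mult_ac)
    finally show ?thesis
      using M1 N0 by (simp add: M_def N_def q_def field_simps)
  qed
qed

lemma reverse_holder:
  assumes p: "p < 1" and y: "\<And>i. i \<in> J \<Longrightarrow> 0 \<le> y i" and a: "\<And>i. i \<in> J \<Longrightarrow> 0 \<le> a i"
    and a': "\<And>i. 0 \<le> p \<Longrightarrow> i \<in> J \<Longrightarrow> 0 < a i"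
  shows "power_mean p w J y * power_mean (dual_exponent p) w J a \<le> (\<Sum>i\<in>J. w i * (a i * y i))"
proof (cases p)
  case MInf
  have "Min (y ` J) * (\<Sum>i\<in>J. w i * a i) = (\<Sum>i\<in>J. w i * (a i * Min (y ` J)))"
    by (simp add: sum_distrib_left mult_ac)
  also have "\<dots> \<le> (\<Sum>i\<in>J. w i * (a i * y i))"
    using a w_pos finite_J by (intro sum_mono mult_left_mono) (auto simp: less_imp_le)
  finally show ?thesis
    using a by (simp add: MInf power_mean_minf power_mean_one dual_exponent_minf)
next
  case (real r)
  then have r1: "r < 1" using p by (simp add: one_ereal_def)
  consider "r = 0" | "0 < r" | "r < 0" by linarith
  then show ?thesis
  proof cases
    case 1
    have "(\<Prod>i\<in>J. y i powr w i) * (\<Prod>i\<in>J. a i powr w i) = (\<Prod>i\<in>J. (a i * y i) powr w i)"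
      using y a by (simp add: powr_mult prod.distrib mult_ac)
    also have "\<dots> \<le> (\<Sum>i\<in>J. w i * (a i * y i))"
      using y a by (intro weighted_arith_geom) auto
    finally show ?thesis
      by (simp add: real 1 dual_exponent_zero power_mean_zero flip: zero_ereal_def)
  next
    case 2
    then show ?thesis using reverse_holder_pos[OF 2 r1, of y a] y a'
      by (simp add: real dual_exponent_real)
  next
    case 3
    show ?thesis
    proof (cases "\<exists>i\<in>J. y i = 0")
      case True
      then have "power_mean p w J y = 0"
        using 3 real by (simp add: power_mean_def)
      then show ?thesis using weighted_sum_nonneg[of "\<lambda>i. a i * y i"] y a by simp
    next
      \<comment> \<open>For a negative exponent \<open>r\<close> the conjugate exponent lies in
        (0,1) and its own conjugate is \<open>r\<close>, so the case already proved applies with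
        \<open>a\<close> and \<open>y\<close> interchanged.\<close>
      case False
      then have "\<And>i. i \<in> J \<Longrightarrow> 0 < y i" using y by force
      moreover have "0 < r / (r - 1)" "r / (r - 1) < 1" "r / (r - 1) / (r / (r - 1) - 1) = r"
        using 3 by (auto simp: field_simps)
      ultimately show ?thesis
        using reverse_holder_pos[of "r / (r - 1)" a y] a
        by (simp add: real dual_exponent_real mult_ac)
    qed
  qed
qed (use p in auto)

text \<open>Equality in Young's inequality forces \<open>y\<close> to be proportional to
  \<open>g powr (q - 1)\<close>; for exponent 0 this is \<open>1 / g\<close>, and for
  \<open>-\<infinity>\<close> a constant. These vectors later serve as test points for a separating
  functional.\<close>

lemma reverse_holder_equality:
  assumes p: "p < 1" and g: "\<And>i. i \<in> J \<Longrightarrow> 0 < g i"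
  obtains y where "\<And>i. i \<in> J \<Longrightarrow> 0 < y i" "power_mean p w J y = 1"
    "(\<Sum>i\<in>J. w i * (g i * y i)) = power_mean (dual_exponent p) w J g"
proof (cases p)
  case MInf
  then show ?thesis
    using that[of "\<lambda>_. 1"] g by (simp add: power_mean_const_1 power_mean_one less_imp_le dual_exponent_minf)
next
  case (real r)
  then have r1: "r < 1" using p by (simp add: one_ereal_def)
  define m where "m = power_mean (dual_exponent p) w J g"
  have m: "0 < m" unfolding m_def using g by (rule power_mean_pos)
  show ?thesis
  proof (cases "r = 0")
    case True
    then have p0: "p = 0" by (simp add: real)
    have mz: "m = (\<Prod>i\<in>J. g i powr w i)"
      by (simp add: m_def p0 dual_exponent_zero power_mean_zero)
    have "power_mean p w J (\<lambda>i. m * (1 / g i)) = m * power_mean p w J (\<lambda>i. 1 / g i)"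
      using m g by (intro power_mean_scale) (auto simp: less_imp_le)
    also have "power_mean p w J (\<lambda>i. 1 / g i) = 1 / m"
      using g by (simp add: p0 mz power_mean_zero powr_divide prod_dividef less_imp_le)
    finally have "power_mean p w J (\<lambda>i. m * (1 / g i)) = 1" using m by simp
    moreover have "(\<Sum>i\<in>J. w i * (g i * (m * (1 / g i)))) = (\<Sum>i\<in>J. w i * m)"
      using g by (intro sum.cong) force+
    then have "(\<Sum>i\<in>J. w i * (g i * (m * (1 / g i)))) = m"
      by (simp add: w_sum flip: sum_distrib_right)
    ultimately show ?thesis using that[of "\<lambda>i. m * (1 / g i)"] g m by (simp add: m_def)
  next
    case False
    define q where "q = r / (r - 1)"
    have q: "q \<noteq> 0" "(q - 1) * r = q" using r1 False by (auto simp: q_def field_simps)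
    define T where "T = (\<Sum>i\<in>J. w i * g i powr q)"
    have T: "0 < T" unfolding T_def using g by (intro weighted_sum_pos) force
    have mT: "m = T powr (1 / q)"
      unfolding m_def T_def using q g
      by (simp add: real dual_exponent_real q_def[symmetric]) (intro power_mean_real, force+)
    then have Tm: "T = m powr q" using q T by (simp add: powr_powr)
    \<comment> \<open>The factor \<open>m powr (1 - q)\<close> makes the mean equal to 1: since
      \<open>(q - 1) * r = q\<close>, the mean of \<open>g powr (q - 1)\<close> is
      \<open>T powr (1 / r) = m powr (q - 1)\<close>.\<close>
    let ?y = "\<lambda>i. m powr (1 - q) * g i powr (q - 1)"
    have y: "0 < ?y i" if "i \<in> J" for i using g[OF that] m by simp
    have "power_mean p w J ?y = m powr (1 - q) * power_mean p w J (\<lambda>i. g i powr (q - 1))"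
      using m g by (intro power_mean_scale) auto
    also have "power_mean p w J (\<lambda>i. g i powr (q - 1)) = T powr (1 / r)"
      unfolding real T_def using False g q
      by (subst power_mean_real) (force simp: powr_powr)+
    also have "\<dots> = m powr (q - 1)"
    proof -
      have "q * (1 / r) = q - 1" using q(2) False by (simp add: field_simps)
      then show ?thesis by (simp only: Tm powr_powr)
    qed
    finally have 1: "power_mean p w J ?y = 1" using m by (simp add: powr_diff)
    have "(\<Sum>i\<in>J. w i * (g i * ?y i)) = (\<Sum>i\<in>J. m powr (1 - q) * (w i * g i powr q))"
    proof (intro sum.cong refl)
      fix i assume "i \<in> J"
      then have "g i * g i powr (q - 1) = g i powr q"
        using g[of i] by (simp add: powr_diff)
      then show "w i * (g i * ?y i) = m powr (1 - q) * (w i * g i powr q)"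
        by (metis mult.left_commute)
    qed
    also have "\<dots> = m powr (1 - q) * m powr q"
      by (simp add: Tm[symmetric] T_def sum_distrib_left)
    also have "\<dots> = m" using m by (simp flip: powr_add)
    finally show ?thesis using that[of ?y] y 1 by (simp add: m_def)
  qed
qed (use p in auto)

text \<open>The equality case read at the conjugate exponent, with \<open>y\<close> as the
  functional: the vector of mean 1 that it yields is the multiplier, and conjugating twice returns
  to \<open>r\<close>.\<close>

lemma multiplier_attained_pos:
  assumes r: "r < 1" and y: "\<And>i. i \<in> J \<Longrightarrow> 0 < y i"
  obtains a where "\<And>i. i \<in> J \<Longrightarrow> 0 < a i" "power_mean (dual_exponent (ereal r)) w J a = 1"
    "(\<Sum>i\<in>J. w i * (a i * y i)) = power_mean (ereal r) w J y"
proof -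
  have "dual_exponent (ereal r) < 1"
    using r by (simp add: dual_exponent_real one_ereal_def field_simps)
  then obtain a where a: "\<And>i. i \<in> J \<Longrightarrow> 0 < a i" "power_mean (dual_exponent (ereal r)) w J a = 1"
    "(\<Sum>i\<in>J. w i * (y i * a i)) = power_mean (dual_exponent (dual_exponent (ereal r))) w J y"
    using reverse_holder_equality[of "dual_exponent (ereal r)" y] y by blast
  then show ?thesis
    using that[of a] by (simp add: dual_exponent_involution[OF r] mult.commute)
qed

text \<open>Allows zero entries to be replaced by small positive ones when the exponent is
  nonnegative, where multipliers must be strictly positive.\<close>

lemma tendsto_power_mean_shift:
  assumes r: "0 \<le> r" and y: "\<And>i. i \<in> J \<Longrightarrow> 0 \<le> y i"
  shows "((\<lambda>d. power_mean (ereal r) w J (\<lambda>i. y i + d)) \<longlongrightarrow> power_mean (ereal r) w J y) (at_right 0)"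
proof -
  have *: "((\<lambda>d. (y i + d) powr s) \<longlongrightarrow> y i powr s) (at_right 0)" if "i \<in> J" "0 < s" for i s
  proof -
    have "((\<lambda>d. y i + d) \<longlongrightarrow> y i + 0) (at_right 0)" by (intro tendsto_intros)
    moreover have "\<forall>\<^sub>F d in at_right 0. 0 \<le> y i + d"
      using y[OF that(1)] by (auto simp: eventually_at_right_field intro!: exI[of _ 1])
    ultimately show ?thesis using that by (intro tendsto_powr2) auto
  qed
  show ?thesis
  proof (cases "r = 0")
    case True
    then show ?thesis using w_pos
      by (auto simp: power_mean_zero simp flip: zero_ereal_def intro!: tendsto_prod *)
  next
    case False
    then have r: "0 < r" using r by simp
    have "((\<lambda>d. (\<Sum>i\<in>J. w i * (y i + d) powr r) powr (1 / r))
        \<longlongrightarrow> (\<Sum>i\<in>J. w i * y i powr r) powr (1 / r)) (at_right 0)"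
      using r by (intro tendsto_powr2 tendsto_sum tendsto_mult tendsto_const *)
        (auto intro!: always_eventually weighted_sum_nonneg)
    then show ?thesis using r by (simp add: power_mean_real)
  qed
qed

text \<open>The slack \<open>e\<close> cannot be dropped: for exponent 0 and \<open>y\<close> with
  some but not all entries zero, the pairing comes arbitrarily close to the mean 0, yet it is
  positive at every strictly positive multiplier.\<close>

lemma multiplier_approx:
  assumes p: "p < 1" and y: "\<And>i. i \<in> J \<Longrightarrow> 0 \<le> y i" and e: "0 < e"
  obtains a where "\<And>i. i \<in> J \<Longrightarrow> 0 \<le> a i" "\<And>i. 0 \<le> p \<Longrightarrow> i \<in> J \<Longrightarrow> 0 < a i"
    "power_mean (dual_exponent p) w J a = 1"
    "(\<Sum>i\<in>J. w i * (a i * y i)) \<le> power_mean p w J y + e"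
proof (cases p)
  case MInf
  have "Min (y ` J) \<in> y ` J" using finite_J J_nonempty by simp
  then obtain j where j: "j \<in> J" "y j = Min (y ` J)" by auto
  \<comment> \<open>All the mass goes to an index of the minimum; the dual exponent is 1, so the
    value \<open>1 / w j\<close> gives mean 1.\<close>
  let ?a = "\<lambda>i. if i = j then 1 / w j else 0"
  have "(\<Sum>i\<in>J. w i * (?a i * f i)) = (\<Sum>i\<in>J. if i = j then f j else 0)" for f
    using w_pos[OF j(1)] by (intro sum.cong) auto
  then have s: "(\<Sum>i\<in>J. w i * (?a i * f i)) = f j" for f
    using j finite_J by simp
  have "power_mean (dual_exponent p) w J ?a = 1"
    using s[of "\<lambda>_. 1"] w_pos[OF j(1)] by (simp add: MInf power_mean_one dual_exponent_minf)
  moreover have "(\<Sum>i\<in>J. w i * (?a i * y i)) \<le> power_mean p w J y + e"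
    unfolding s using e j by (simp add: MInf power_mean_minf)
  ultimately show ?thesis using that[of ?a] w_pos[OF j(1)] by (simp add: MInf)
next
  case (real r)
  then have r1: "r < 1" using p by (simp add: one_ereal_def)
  consider "0 \<le> r" | "r < 0" "\<forall>i\<in>J. 0 < y i" | j where "r < 0" "j \<in> J" "y j = 0"
    using y by force
  then show ?thesis
  proof cases
    case 1
    \<comment> \<open>Shift \<open>y\<close> away from zero by a \<open>d\<close> that costs less
      than \<open>e\<close>. The exact multiplier of the shifted vector does at least as well on
      \<open>y\<close>, since its entries are positive.\<close>
    have "\<forall>\<^sub>F d in at_right 0. power_mean (ereal r) w J (\<lambda>i. y i + d) < power_mean (ereal r) w J y + e"
      by (rule order_tendstoD(2)[OF tendsto_power_mean_shift[OF 1, of y]]) (use y e in auto)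
    then obtain d where d: "0 < d"
      "power_mean (ereal r) w J (\<lambda>i. y i + d) < power_mean (ereal r) w J y + e"
      by (metis (mono_tags, lifting) dense eventually_at_right_field)
    obtain a where a: "\<And>i. i \<in> J \<Longrightarrow> 0 < a i" "power_mean (dual_exponent (ereal r)) w J a = 1"
      "(\<Sum>i\<in>J. w i * (a i * (y i + d))) = power_mean (ereal r) w J (\<lambda>i. y i + d)"
      by (rule multiplier_attained_pos[OF r1, of "\<lambda>i. y i + d"])
        (use y d in \<open>auto simp: add_nonneg_pos\<close>)
    have "(\<Sum>i\<in>J. w i * (a i * y i)) \<le> (\<Sum>i\<in>J. w i * (a i * (y i + d)))"
      using a(1) w_pos d by (intro sum_mono mult_left_mono) (auto simp: less_imp_le)
    then show ?thesis using that[of a] a d by (simp add: real less_imp_le)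
  next
    case 2
    then obtain a where a: "\<And>i. i \<in> J \<Longrightarrow> 0 < a i" "power_mean (dual_exponent (ereal r)) w J a = 1"
      "(\<Sum>i\<in>J. w i * (a i * y i)) = power_mean (ereal r) w J y"
      using multiplier_attained_pos[OF r1, of y] by blast
    then show ?thesis using that[of a] e by (simp add: real less_imp_le)
  next
    case 3
    define q where "q = r / (r - 1)"
    have q: "0 < q" using 3 by (simp add: q_def zero_less_divide_iff)
    \<comment> \<open>A multiplier supported on the zero entry \<open>j\<close> pairs to 0 with
      \<open>y\<close>; negative exponents admit zero entries in a multiplier. The value at
      \<open>j\<close> makes the single term \<open>w j * ?a j powr q\<close> equal to 1.\<close>
    let ?a = "\<lambda>i. if i = j then w j powr (- 1 / q) else 0"
    have "power_mean (dual_exponent p) w J ?a = (\<Sum>i\<in>J. w i * ?a i powr q) powr (1 / q)"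
      unfolding real dual_exponent_real q_def[symmetric] using q by (intro power_mean_real) auto
    also have "(\<Sum>i\<in>J. w i * ?a i powr q) = (\<Sum>i\<in>J. if i = j then 1 else 0)"
    proof -
      have "(w j powr (- 1 / q)) powr q = 1 / w j"
        unfolding powr_powr using q w_pos[OF 3(2)] by (simp add: powr_minus_divide)
      then show ?thesis using w_pos[OF 3(2)] by (intro sum.cong) auto
    qed
    finally have "power_mean (dual_exponent p) w J ?a = 1"
      using 3 finite_J by simp
    moreover have "(\<Sum>i\<in>J. w i * (?a i * y i)) = 0"
      using 3 by (intro sum.neutral) auto
    ultimately show ?thesis
      using that[of ?a] 3 e power_mean_nonneg[of y p] y real by (simp add: add_nonneg_nonneg)
  qed
qed (use p in auto)

end

section \<open>Rayleigh characterisation of the extreme eigenvalues of a symmetric matrix\<close>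

section \<open>Extreme eigenvalues\<close>

lemma sym_matrix_inner: "sym_matrix M \<Longrightarrow> (M *v x) \<bullet> y = x \<bullet> (M *v y)"
  for M :: "real^'n^'n"
  by (metis dot_lmul_matrix sym_matrix_def transpose_matrix_vector)

lemma quad_form_scaleR: "quad_form M (c *\<^sub>R x) = c\<^sup>2 * quad_form M x"
  by (simp add: quad_form_def matrix_vector_mult_scaleR power2_eq_square)

lemma quad_form_diff_mat: "quad_form (M - c *\<^sub>R mat 1) x = quad_form M x - c * (x \<bullet> x)"
  by (simp add: quad_form_def matrix_vector_mult_diff_rdistrib scaleR_matrix_vector_assoc[symmetric] inner_diff_right)

lemma quad_form_uminus: "quad_form (- M) x = - quad_form M x"
  by (simp add: quad_form_def matrix_vector_mult_def inner_vec_def sum_negf)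

lemma continuous_on_quad_form: "continuous_on S (quad_form M)"
  unfolding quad_form_def by (intro continuous_intros)

lemma quad_form_eigenvector: "M *v v = c *\<^sub>R v \<Longrightarrow> quad_form M v = c * (v \<bullet> v)"
  by (simp add: quad_form_def)

text \<open>Eigenvectors for distinct eigenvalues are orthogonal, hence independent, and an
  independent set is finite here. This makes the \<open>Min\<close> and \<open>Max\<close> over
  eigenvalues meaningful.\<close>

lemma finite_eigenvalues:
  fixes M :: "real^'n^'n"
  assumes "sym_matrix M"
  shows "finite (eigenvalues M)"
proof -
  define v where "v c = (SOME v. v \<noteq> 0 \<and> M *v v = c *\<^sub>R v)" for c
  have v: "v c \<noteq> 0" "M *v v c = c *\<^sub>R v c" if "c \<in> eigenvalues M" for c
    using someI_ex[of "\<lambda>v. v \<noteq> 0 \<and> M *v v = c *\<^sub>R v"] that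
    by (auto simp: v_def eigenvalues_def)
  have orth: "orthogonal (v c) (v d)" if "c \<in> eigenvalues M" "d \<in> eigenvalues M" "c \<noteq> d" for c d
    using sym_matrix_inner[OF assms, of "v c" "v d"] v that by (simp add: orthogonal_def)
  have "inj_on v (eigenvalues M)"
    using orth v by (metis inj_onI orthogonal_self)
  moreover have "independent (v ` eigenvalues M)"
    by (rule pairwise_orthogonal_independent) (use orth v in \<open>auto simp: pairwise_def\<close>)
  ultimately show ?thesis
    using finite_imageD independent_imp_finite by blast
qed

text \<open>If \<open>z = N *v x\<close> were nonzero, a short step from \<open>x\<close> in
  direction \<open>- z\<close> would make the form negative: the first-order term
  \<open>- 2 * t * (z \<bullet> z)\<close> dominates.\<close>

lemma quad_form_zero_imp_kernel:
  fixes N :: "real^'n^'n"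
  assumes sym: "sym_matrix N" and nonneg: "\<And>x. 0 \<le> quad_form N x" and zero: "quad_form N x = 0"
  shows "N *v x = 0"
proof (rule ccontr)
  assume "N *v x \<noteq> 0"
  define z where "z = N *v x"
  define c where "c = quad_form N z"
  have z: "0 < z \<bullet> z" using \<open>N *v x \<noteq> 0\<close> by (simp add: z_def)
  have c: "0 \<le> c" using nonneg by (simp add: c_def)
  have xz: "x \<bullet> (N *v z) = z \<bullet> z"
    using sym_matrix_inner[OF sym, of x z] by (simp add: z_def)
  have "quad_form N (x - t *\<^sub>R z) = t * (t * c - 2 * (z \<bullet> z))" for t
  proof -
    have "quad_form N (x - t *\<^sub>R z) = quad_form N x - t * (z \<bullet> (N *v x)) - t * (x \<bullet> (N *v z)) + t\<^sup>2 * c"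
      by (simp add: quad_form_def c_def matrix_vector_mult_diff_distrib matrix_vector_mult_scaleR
          inner_diff_left inner_diff_right power2_eq_square algebra_simps)
    then show ?thesis
      using zero xz by (simp add: z_def[symmetric] algebra_simps power2_eq_square)
  qed
  \<comment> \<open>The \<open>+ 1\<close> avoids division by zero when \<open>c = 0\<close> and
    still gives \<open>t * c \<le> z \<bullet> z\<close>.\<close>
  moreover define t where "t = (z \<bullet> z) / (c + 1)"
  have "0 < t" "t * c - 2 * (z \<bullet> z) < 0"
  proof -
    show "0 < t" using z c by (simp add: t_def)
    have "t * c \<le> z \<bullet> z" using z c by (simp add: t_def field_simps)
    then show "t * c - 2 * (z \<bullet> z) < 0" using z by linarith
  qed
  ultimately show False
    using nonneg[of "x - t *\<^sub>R z"] by (metis mult_pos_neg not_le)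
qed

text \<open>The form attains its minimum \<open>c\<close> on the compact unit sphere. Then
  \<open>M - c *\<^sub>R mat 1\<close> has a nonnegative form vanishing at the minimiser, so the
  minimiser lies in its kernel and is an eigenvector for \<open>c\<close>.\<close>

lemma Rayleigh_min:
  fixes M :: "real^'n^'n"
  assumes "sym_matrix M"
  shows "\<exists>c x. c \<in> eigenvalues M \<and> norm x = 1 \<and> quad_form M x = c \<and> (\<forall>y. c * (y \<bullet> y) \<le> quad_form M y)"
proof -
  have "sphere 0 1 \<noteq> ({} :: (real^'n) set)" by simp
  then obtain x where x: "norm x = 1" "\<And>y. norm y = 1 \<Longrightarrow> quad_form M x \<le> quad_form M y"
    using continuous_attains_inf[OF compact_sphere _ continuous_on_quad_form, of 0 1 M] by auto
  define c where "c = quad_form M x"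
  have low: "c * (y \<bullet> y) \<le> quad_form M y" for y
  proof (cases "y = 0")
    case False
    have "c \<le> quad_form M ((1 / norm y) *\<^sub>R y)" unfolding c_def using False by (intro x) simp
    then show ?thesis using False
      by (simp add: quad_form_scaleR power_divide field_simps dot_square_norm)
  qed (simp add: quad_form_def)
  have "sym_matrix (M - c *\<^sub>R mat 1)"
    using assms by (auto simp: sym_matrix_def transpose_def vec_eq_iff mat_def)
  moreover have "quad_form (M - c *\<^sub>R mat 1) x = 0"
    using x by (simp add: quad_form_diff_mat c_def dot_square_norm)
  ultimately have "(M - c *\<^sub>R mat 1) *v x = 0"
    using low by (intro quad_form_zero_imp_kernel) (auto simp: quad_form_diff_mat)
  then have "M *v x = c *\<^sub>R x"
    by (simp add: matrix_vector_mult_diff_rdistrib scaleR_matrix_vector_assoc[symmetric])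
  then have "c \<in> eigenvalues M" using x by (auto simp: eigenvalues_def intro!: exI[of _ x])
  then show ?thesis using x low c_def by blast
qed

lemma lambda_min_eqI:
  assumes "sym_matrix M" "c \<in> eigenvalues M" "\<And>y. c * (y \<bullet> y) \<le> quad_form M y"
  shows "lambda_min M = c"
  unfolding lambda_min_def
proof (rule Min_eqI)
  fix d assume "d \<in> eigenvalues M"
  then obtain v where "v \<noteq> 0" "M *v v = d *\<^sub>R v" by (auto simp: eigenvalues_def)
  with assms(3)[of v] show "c \<le> d" by (simp add: quad_form_eigenvector)
qed (use assms finite_eigenvalues in auto)

lemma lambda_min_le:
  assumes "sym_matrix M" "norm x = 1"
  shows "lambda_min M \<le> quad_form M x"
proof -
  obtain c where c: "c \<in> eigenvalues M" "\<And>y. c * (y \<bullet> y) \<le> quad_form M y"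
    using Rayleigh_min[OF assms(1)] by blast
  then have "lambda_min M = c" using assms(1) by (intro lambda_min_eqI)
  then show ?thesis using c(2)[of x] assms(2) by (simp add: dot_square_norm)
qed

lemma lambda_min_attained:
  assumes "sym_matrix M"
  obtains x where "norm x = 1" "quad_form M x = lambda_min M"
proof -
  obtain c x where c: "c \<in> eigenvalues M" "norm x = 1" "quad_form M x = c"
      "\<And>y. c * (y \<bullet> y) \<le> quad_form M y"
    using Rayleigh_min[OF assms(1)] by blast
  then have "lambda_min M = c" using assms(1) by (intro lambda_min_eqI)
  then show ?thesis using c that by simp
qed

lemma eigenvalues_uminus: "eigenvalues (- M) = uminus ` eigenvalues M"
proof -
  have *: "(- M) *v v = - (M *v v)" for v
    by (simp add: matrix_vector_mult_def vec_eq_iff sum_negf)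
  have "(- M) *v v = c *\<^sub>R v \<longleftrightarrow> M *v v = (- c) *\<^sub>R v" for v c
    unfolding * by (metis minus_equation_iff scaleR_minus_left)
  then have *: "c \<in> eigenvalues (- M) \<longleftrightarrow> - c \<in> eigenvalues M" for c
    by (auto simp: eigenvalues_def)
  show ?thesis
  proof (intro set_eqI iffI)
    fix c assume "c \<in> eigenvalues (- M)"
    then have "- c \<in> eigenvalues M" by (rule *[THEN iffD1])
    then show "c \<in> uminus ` eigenvalues M" by (rule rev_image_eqI) simp
  next
    fix c assume "c \<in> uminus ` eigenvalues M"
    then obtain d where "c = - d" "d \<in> eigenvalues M" by blast
    then show "c \<in> eigenvalues (- M)" unfolding * by simp
  qed
qed

lemma lambda_max_uminus:
  assumes "sym_matrix M"
  shows "lambda_max M = - lambda_min (- M)"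
proof -
  have "eigenvalues M \<noteq> {}" using Rayleigh_min[OF assms] by auto
  then show ?thesis
    using finite_eigenvalues[OF assms]
    by (simp add: lambda_max_def lambda_min_def eigenvalues_uminus image_image)
qed

lemma sym_matrix_uminus: "sym_matrix M \<Longrightarrow> sym_matrix (- M)"
  by (auto simp: sym_matrix_def transpose_def vec_eq_iff)

lemma lambda_max_ge: "sym_matrix M \<Longrightarrow> norm x = 1 \<Longrightarrow> quad_form M x \<le> lambda_max M"
  using lambda_min_le[of "- M" x] by (simp add: lambda_max_uminus sym_matrix_uminus quad_form_uminus)

lemma lambda_max_attained:
  assumes "sym_matrix M"
  obtains x where "norm x = 1" "quad_form M x = lambda_max M"
proof -
  obtain x where "norm x = 1" "quad_form (- M) x = lambda_min (- M)"
    using lambda_min_attained[OF sym_matrix_uminus[OF assms]] .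
  then show ?thesis using that lambda_max_uminus[OF assms] by (simp add: quad_form_uminus)
qed

text \<open>Turns a Rayleigh quotient into the linear pairing on the right-hand side of the reverse
  Hoelder inequality.\<close>

lemma quad_form_weighted_matrix:
  "quad_form (weighted_matrix w A \<alpha>) x = (\<Sum>i\<in>UNIV. w i * (\<alpha> $ i * quad_form (A i) x))"
proof -
  have "(\<Sum>i\<in>S. (\<alpha> $ i * w i) *\<^sub>R A i) *v x = (\<Sum>i\<in>S. (\<alpha> $ i * w i) *\<^sub>R (A i *v x))"
    if "finite S" for S
    using that
    by (induction S) (simp_all add: matrix_vector_mult_add_rdistrib scaleR_matrix_vector_assoc)
  then show ?thesis
    by (simp add: quad_form_def weighted_matrix_def inner_sum_right mult_ac)
qed

lemma sym_weighted_matrix: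
  assumes "\<And>i. sym_matrix (A i)"
  shows "sym_matrix (weighted_matrix w A \<alpha>)"
proof -
  have "A i $ r $ s = A i $ s $ r" for i r s
  proof -
    have "A i $ r $ s = transpose (A i) $ r $ s" using assms[of i] by (simp add: sym_matrix_def)
    then show ?thesis by (simp add: transpose_def)
  qed
  then show ?thesis
    by (simp add: sym_matrix_def transpose_def weighted_matrix_def vec_eq_iff)
qed

section \<open>From convexity of the lower envelope to convexity of the image of the unit
  ball\<close>

section \<open>Lower envelopes\<close>

text \<open>The feasible set is closed, and only its part in a fixed ball matters for the infimum,
  so compactness gives a feasible point of least norm.\<close>

lemma lower_envelope_attained:
  fixes A :: "'i::finite \<Rightarrow> real^'n^'n"
  assumes "lower_envelope A (mat 1) a \<le> 1"
  obtains x where "norm x \<le> 1" "\<And>i. quad_form (A i) x = a $ i"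
proof -
  define F where "F = {x. \<forall>i. quad_form (A i) x = a $ i}"
  have I: "quad_form (mat 1) x = (norm x)\<^sup>2" for x :: "real^'n"
    by (simp add: quad_form_def dot_square_norm)
  have inf: "lower_envelope A (mat 1) a = (INF x\<in>F. ereal ((norm x)\<^sup>2))"
    by (simp add: lower_envelope_def F_def I)
  \<comment> \<open>Any bound above 1 would do; 4 gives a feasible point in the ball of radius 2, so
    the compact set below is nonempty.\<close>
  have "(INF x\<in>F. ereal ((norm x)\<^sup>2)) < 4"
    using assms inf by (simp add: order_le_less_trans[of _ 1])
  then obtain x0 where x0: "x0 \<in> F" "(norm x0)\<^sup>2 < 2\<^sup>2"
    by (auto simp: INF_less_iff)
  have "norm x0 \<le> 2" using power2_less_imp_less[OF x0(2)] by simp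
  then have ne: "F \<inter> cball 0 2 \<noteq> {}" using x0 by auto
  have "F = (\<Inter>i. {x. quad_form (A i) x = a $ i})" by (auto simp: F_def)
  moreover have "closed {x. quad_form (A i) x = a $ i}" for i
    by (intro closed_Collect_eq continuous_on_quad_form continuous_on_const)
  ultimately have "closed F" by (simp add: closed_INT)
  then have "compact (F \<inter> cball 0 2)" by (simp add: closed_Int_compact)
  then obtain x where x: "x \<in> F" "norm x \<le> 2" "\<And>y. y \<in> F \<Longrightarrow> norm y \<le> 2 \<Longrightarrow> norm x \<le> norm y"
    using continuous_attains_inf[OF _ ne continuous_on_norm_id] by auto
  then have "norm x \<le> norm y" if "y \<in> F" for y
    using that by (cases "norm y \<le> 2") auto
  then have "ereal ((norm x)\<^sup>2) \<le> (INF x\<in>F. ereal ((norm x)\<^sup>2))"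
    by (intro INF_greatest) (simp add: power_mono)
  then have "ereal ((norm x)\<^sup>2) \<le> 1" using assms inf by (metis order_trans)
  then have "norm x \<le> 1"
    by (simp add: one_ereal_def abs_square_le_1)
  then show ?thesis using that x(1) by (auto simp: F_def)
qed

text \<open>The image is exactly the sublevel set of the envelope at level 1, attainment giving the
  harder inclusion, and sublevel sets of a convex function are convex.\<close>

lemma convex_unit_ball_image:
  fixes A :: "'i::finite \<Rightarrow> real^'n^'n"
  assumes "ext_convex (lower_envelope A (mat 1))"
  shows "convex ((\<lambda>x. \<chi> i. quad_form (A i) x) ` cball 0 1)"
proof -
  let ?P = "(\<lambda>x. \<chi> i. quad_form (A i) x) ` cball 0 1"
  let ?V = "lower_envelope A (mat 1)"
  have mem: "a \<in> ?P \<longleftrightarrow> ?V a \<le> 1" for a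
  proof
    assume "a \<in> ?P"
    then obtain x where x: "norm x \<le> 1" "a = (\<chi> i. quad_form (A i) x)" by auto
    then have "?V a \<le> ereal (quad_form (mat 1) x)"
      unfolding lower_envelope_def by (intro INF_lower) auto
    also have "\<dots> \<le> 1"
      using x(1) by (simp add: quad_form_def dot_square_norm abs_square_le_1)
    finally show "?V a \<le> 1" .
  next
    assume "?V a \<le> 1"
    then obtain x where x: "norm x \<le> 1" "\<And>i. quad_form (A i) x = a $ i"
      using lower_envelope_attained by blast
    then have "a = (\<chi> i. quad_form (A i) x)" by (simp add: vec_eq_iff)
    then show "a \<in> ?P" using x(1) by auto
  qed
  show ?thesis
    unfolding convex_alt
  proof (intro ballI allI impI)
    fix a b and t :: real
    assume ab: "a \<in> ?P" "b \<in> ?P" and t: "0 \<le> t \<and> t \<le> 1"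
    show "(1 - t) *\<^sub>R a + t *\<^sub>R b \<in> ?P"
    \<comment> \<open>The endpoints are treated apart because \<open>ext_convex\<close> speaks only
      of \<open>0 < t < 1\<close>.\<close>
    proof (cases "t = 0 \<or> t = 1")
      case True
      then show ?thesis using ab by auto
    next
      case False
      then have "?V ((1 - t) *\<^sub>R a + t *\<^sub>R b) \<le> ereal (1 - t) * ?V a + ereal t * ?V b"
        using assms t by (auto simp: ext_convex_def)
      also have "\<dots> \<le> ereal (1 - t) * 1 + ereal t * 1"
        using ab t unfolding mem by (intro add_mono ereal_mult_left_mono) auto
      also have "\<dots> = 1" by (simp add: one_ereal_def)
      finally show ?thesis by (simp add: mem)
    qed
  qed
qed

section \<open>Assembling the groups, and the exchange of infima for the smallest eigenvalue\<close>

section \<open>Duality\<close>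

locale grouped_forms =
  fixes K :: nat
    and G :: "nat \<Rightarrow> 'i::finite set"
    and p :: "nat \<Rightarrow> ereal"
    and w :: "'i \<Rightarrow> real"
    and A :: "'i \<Rightarrow> real^'n^'n"
  assumes disjoint: "disjoint_family_on G {1..K}"
    and cover: "(\<Union>k\<in>{1..K}. G k) = UNIV"
    and exponents: "\<And>k. k \<in> {1..K} \<Longrightarrow> p k < 1"
    and weights_pos: "\<And>i. 0 < w i"
    and weights_sum: "\<And>k. k \<in> {1..K} \<Longrightarrow> (\<Sum>i\<in>G k. w i) = 1"
    and A_psd: "\<And>i. psd_matrix (A i)"
begin

abbreviation weighted :: "real^'i \<Rightarrow> real^'n^'n" where
  "weighted \<equiv> weighted_matrix w A"

abbreviation means :: "('i \<Rightarrow> real) \<Rightarrow> real" where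
  "means v \<equiv> (\<Sum>k=1..K. power_mean (p k) w (G k) v)"

abbreviation pairing :: "real^'i \<Rightarrow> ('i \<Rightarrow> real) \<Rightarrow> real" where
  "pairing \<alpha> v \<equiv> (\<Sum>i\<in>UNIV. w i * (\<alpha> $ i * v i))"

abbreviation \<A> :: "(real^'i) set" where
  "\<A> \<equiv> multipliers K G p w"

lemma prob_weights_group: "k \<in> {1..K} \<Longrightarrow> prob_weights (G k) w"
  using weights_pos weights_sum by (simp add: prob_weights_def)

lemma sum_groups: "(\<Sum>i\<in>UNIV. f i) = (\<Sum>k=1..K. \<Sum>i\<in>G k. f i)"
  unfolding cover[symmetric] using disjoint
  by (intro sum.UNION_disjoint) (auto simp: disjoint_family_on_def)

lemma quad_form_A_nonneg: "0 \<le> quad_form (A i) x"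
  using A_psd[of i] by (simp add: psd_matrix_def)

lemma sym_weighted: "sym_matrix (weighted \<alpha>)"
  using A_psd by (intro sym_weighted_matrix) (simp add: psd_matrix_def)

lemma group_multiplier:
  assumes "\<alpha> \<in> \<A>" "k \<in> {1..K}"
  shows "\<And>i. i \<in> G k \<Longrightarrow> 0 \<le> \<alpha> $ i" "\<And>i. 0 \<le> p k \<Longrightarrow> i \<in> G k \<Longrightarrow> 0 < \<alpha> $ i"
    "power_mean (dual_exponent (p k)) w (G k) (($) \<alpha>) = 1"
  using assms by (auto simp: multipliers_def multiplier_cyl_def less_imp_le split: if_splits)

lemma multiplier_nonneg: "\<alpha> \<in> \<A> \<Longrightarrow> 0 \<le> \<alpha> $ i"
  using group_multiplier(1) cover by blast

text \<open>The product structure of the multiplier set: each index lies in exactly one group, so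
  choices made group by group combine into one vector.\<close>

lemma multipliers_glue:
  assumes "\<And>k i. k \<in> {1..K} \<Longrightarrow> i \<in> G k \<Longrightarrow> 0 \<le> a k i"
    and "\<And>k i. k \<in> {1..K} \<Longrightarrow> 0 \<le> p k \<Longrightarrow> i \<in> G k \<Longrightarrow> 0 < a k i"
    and "\<And>k. k \<in> {1..K} \<Longrightarrow> power_mean (dual_exponent (p k)) w (G k) (a k) = 1"
  obtains \<alpha> where "\<alpha> \<in> \<A>" "\<And>k i. k \<in> {1..K} \<Longrightarrow> i \<in> G k \<Longrightarrow> \<alpha> $ i = a k i"
proof -
  have "\<forall>i. \<exists>k. k \<in> {1..K} \<and> i \<in> G k" using cover by blast
  then obtain g where g: "\<And>i. g i \<in> {1..K}" "\<And>i. i \<in> G (g i)" by metis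
  have gk: "g i = k" if "k \<in> {1..K}" "i \<in> G k" for i k
    using disjoint g[of i] that unfolding disjoint_family_on_def by blast
  define \<alpha> :: "real^'i" where "\<alpha> = (\<chi> i. a (g i) i)"
  have \<alpha>: "\<alpha> $ i = a k i" if "k \<in> {1..K}" "i \<in> G k" for i k
    using gk[OF that] by (simp add: \<alpha>_def)
  have "\<alpha> \<in> multiplier_cyl (p k) w (G k)" if k: "k \<in> {1..K}" for k
  proof -
    have "power_mean (dual_exponent (p k)) w (G k) (($) \<alpha>) = 1"
      using assms(3)[OF k] power_mean_cong[of "G k" "($) \<alpha>" "a k"] \<alpha>[OF k] by simp
    then show ?thesis
      using assms(1,2)[OF k] \<alpha>[OF k] by (auto simp: multiplier_cyl_def not_less)
  qed
  then have "\<alpha> \<in> \<A>" by (simp add: multipliers_def)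
  then show ?thesis using that \<alpha> by blast
qed

lemma multipliers_nonempty: "\<A> \<noteq> {}"
  by (rule multipliers_glue[of "\<lambda>_ _. 1"])
    (auto simp: prob_weights.power_mean_const_1[OF prob_weights_group])

lemma means_nonneg: "(\<And>i. 0 \<le> v i) \<Longrightarrow> 0 \<le> means v"
  by (intro sum_nonneg prob_weights.power_mean_nonneg prob_weights_group) auto

lemma means_le_pairing:
  assumes "\<alpha> \<in> \<A>" "\<And>i. 0 \<le> v i"
  shows "means v \<le> pairing \<alpha> v"
  unfolding sum_groups
proof (intro sum_mono)
  fix k assume k: "k \<in> {1..K}"
  show "power_mean (p k) w (G k) v \<le> (\<Sum>i\<in>G k. w i * (\<alpha> $ i * v i))"
    using prob_weights.reverse_holder[OF prob_weights_group[OF k] exponents[OF k], of v "($) \<alpha>"]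
      group_multiplier[OF assms(1) k] assms(2) by simp
qed

text \<open>Each group is approximated within \<open>e / K\<close>, and the choices are glued.
  \<open>K\<close> is positive because the groups cover a nonempty index type.\<close>

lemma pairing_approx_means:
  assumes v: "\<And>i. 0 \<le> v i" and e: "0 < e"
  obtains \<alpha> where "\<alpha> \<in> \<A>" "pairing \<alpha> v \<le> means v + e"
proof -
  have K: "0 < K" using cover by (cases K) auto
  define \<Phi> where "\<Phi> k a \<longleftrightarrow> (\<forall>i\<in>G k. 0 \<le> a i) \<and> (0 \<le> p k \<longrightarrow> (\<forall>i\<in>G k. 0 < a i)) \<and>
      power_mean (dual_exponent (p k)) w (G k) a = 1 \<and>
      (\<Sum>i\<in>G k. w i * (a i * v i)) \<le> power_mean (p k) w (G k) v + e / K" for k a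
  have "\<exists>a. \<Phi> k a" if k: "k \<in> {1..K}" for k
  proof -
    have "0 < e / K" using e K by simp
    then obtain a where "\<And>i. i \<in> G k \<Longrightarrow> 0 \<le> a i" "\<And>i. 0 \<le> p k \<Longrightarrow> i \<in> G k \<Longrightarrow> 0 < a i"
      "power_mean (dual_exponent (p k)) w (G k) a = 1"
      "(\<Sum>i\<in>G k. w i * (a i * v i)) \<le> power_mean (p k) w (G k) v + e / K"
      using prob_weights.multiplier_approx[OF prob_weights_group[OF k] exponents[OF k], of v, OF v]
      by blast
    then show ?thesis unfolding \<Phi>_def by blast
  qed
  then obtain a where "\<forall>k\<in>{1..K}. \<Phi> k (a k)"
    using bchoice[of "{1..K}" \<Phi>] by blast
  then have "\<Phi> k (a k)" if "k \<in> {1..K}" for k using that by blast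
  note a = this[unfolded \<Phi>_def]
  obtain \<alpha> where \<alpha>: "\<alpha> \<in> \<A>" "\<And>k i. k \<in> {1..K} \<Longrightarrow> i \<in> G k \<Longrightarrow> \<alpha> $ i = a k i"
    by (rule multipliers_glue[of a]) (use a in simp_all)
  have "pairing \<alpha> v \<le> (\<Sum>k=1..K. power_mean (p k) w (G k) v + e / K)"
    unfolding sum_groups
  proof (intro sum_mono)
    fix k assume k: "k \<in> {1..K}"
    then have "(\<Sum>i\<in>G k. w i * (\<alpha> $ i * v i)) = (\<Sum>i\<in>G k. w i * (a k i * v i))"
      using \<alpha>(2) by (intro sum.cong) auto
    then show "(\<Sum>i\<in>G k. w i * (\<alpha> $ i * v i)) \<le> power_mean (p k) w (G k) v + e / K"
      using a[OF k] by simp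
  qed
  also have "\<dots> = means v + e" using K by (simp add: sum.distrib)
  finally show ?thesis using that \<alpha>(1) by blast
qed

lemma mean_sum_le: "\<alpha> \<in> \<A> \<Longrightarrow> mean_sum K G p w A x \<le> quad_form (weighted \<alpha>) x"
  using means_le_pairing quad_form_A_nonneg by (simp add: mean_sum_def quad_form_weighted_matrix)

lemma mean_sum_nonneg: "0 \<le> mean_sum K G p w A x"
  unfolding mean_sum_def using quad_form_A_nonneg by (rule means_nonneg)

lemma quad_form_weighted_nonneg: "\<alpha> \<in> \<A> \<Longrightarrow> 0 \<le> quad_form (weighted \<alpha>) x"
  using mean_sum_le mean_sum_nonneg by (metis order_trans)

lemma unit_vectors_nonempty: "{x :: real^'n. norm x = 1} \<noteq> {}"
  using vector_choose_size[of 1] by auto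

text \<open>Both sides are the infimum of \<open>quad_form (weighted \<alpha>) x\<close> over all
  pairs of a multiplier and a unit vector, taken in the two orders. Nonnegativity supplies the lower
  bounds that real infima require.\<close>

lemma INF_mean_sum:
  "(INF x\<in>{x. norm x = 1}. mean_sum K G p w A x) = (INF \<alpha>\<in>\<A>. lambda_min (weighted \<alpha>))"
proof (rule antisym)
  have bdd: "bdd_below (mean_sum K G p w A ` {x. norm x = 1})"
    using mean_sum_nonneg by (intro bdd_belowI2)
  show "(INF x\<in>{x. norm x = 1}. mean_sum K G p w A x) \<le> (INF \<alpha>\<in>\<A>. lambda_min (weighted \<alpha>))"
  proof (rule cINF_greatest[OF multipliers_nonempty])
    fix \<alpha> assume \<alpha>: "\<alpha> \<in> \<A>"
    obtain x where x: "norm x = 1" "quad_form (weighted \<alpha>) x = lambda_min (weighted \<alpha>)"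
      using lambda_min_attained[OF sym_weighted] .
    have "(INF x\<in>{x. norm x = 1}. mean_sum K G p w A x) \<le> mean_sum K G p w A x"
      using bdd x(1) by (intro cINF_lower) auto
    then show "(INF x\<in>{x. norm x = 1}. mean_sum K G p w A x) \<le> lambda_min (weighted \<alpha>)"
      using mean_sum_le[OF \<alpha>, of x] x(2) by simp
  qed
  have "0 \<le> lambda_min (weighted \<alpha>)" if "\<alpha> \<in> \<A>" for \<alpha>
    using lambda_min_attained[OF sym_weighted] quad_form_weighted_nonneg[OF that] by metis
  then have bdd': "bdd_below ((\<lambda>\<alpha>. lambda_min (weighted \<alpha>)) ` \<A>)"
    by (intro bdd_belowI2)
  show "(INF \<alpha>\<in>\<A>. lambda_min (weighted \<alpha>)) \<le> (INF x\<in>{x. norm x = 1}. mean_sum K G p w A x)"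
  proof (rule cINF_greatest[OF unit_vectors_nonempty])
    fix x :: "real^'n" assume "x \<in> {x. norm x = 1}"
    then have x: "norm x = 1" by simp
    show "(INF \<alpha>\<in>\<A>. lambda_min (weighted \<alpha>)) \<le> mean_sum K G p w A x"
    proof (rule field_le_epsilon)
      fix e :: real assume "0 < e"
      then obtain \<alpha> where \<alpha>: "\<alpha> \<in> \<A>"
        "pairing \<alpha> (\<lambda>i. quad_form (A i) x) \<le> means (\<lambda>i. quad_form (A i) x) + e"
        using pairing_approx_means[of "\<lambda>i. quad_form (A i) x", OF quad_form_A_nonneg] by blast
      have "(INF \<alpha>\<in>\<A>. lambda_min (weighted \<alpha>)) \<le> lambda_min (weighted \<alpha>)"
        using bdd' \<alpha>(1) by (intro cINF_lower)
      also have "\<dots> \<le> quad_form (weighted \<alpha>) x" using sym_weighted x by (rule lambda_min_le)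
      also have "\<dots> \<le> mean_sum K G p w A x + e"
        using \<alpha>(2) by (simp add: quad_form_weighted_matrix mean_sum_def)
      finally show "(INF \<alpha>\<in>\<A>. lambda_min (weighted \<alpha>)) \<le> mean_sum K G p w A x + e" .
    qed
  qed
qed

section \<open>Strong duality for the largest eigenvalue by separation of convex sets\<close>

lemma mean_sum_le_lambda_max:
  "\<alpha> \<in> \<A> \<Longrightarrow> norm x = 1 \<Longrightarrow> mean_sum K G p w A x \<le> lambda_max (weighted \<alpha>)"
  using mean_sum_le lambda_max_ge[OF sym_weighted] by (metis order_trans)

text \<open>The strict bound \<open>s\<close> keeps the compact set \<open>P\<close> of attainable
  form values apart from the closed set \<open>Q\<close>; the separating functional, made positive
  and normalised in each group, is the multiplier sought.\<close>

lemma multiplier_above_sup: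
  assumes conv: "convex ((\<lambda>x. \<chi> i. quad_form (A i) x) ` cball 0 1)"
    and s: "0 < s" "\<And>x. norm x = 1 \<Longrightarrow> mean_sum K G p w A x < s"
  obtains \<alpha> where "\<alpha> \<in> \<A>" "lambda_max (weighted \<alpha>) \<le> s"
proof -
  define P where "P = (\<lambda>x. \<chi> i. quad_form (A i) x) ` cball 0 1"
  \<comment> \<open>By duality this is the set of nonnegative \<open>v\<close> with
    \<open>s \<le> means v\<close>; as an intersection of halfspaces it is visibly closed and
    convex.\<close>
  define Q where "Q = (\<Inter>i. {v :: real^'i. 0 \<le> v $ i}) \<inter> (\<Inter>\<alpha>\<in>\<A>. {v. s \<le> pairing \<alpha> (($) v)})"
  have P: "convex P" "compact P" "P \<noteq> {}"
  proof -
    show "compact P" unfolding P_def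
      by (intro compact_continuous_image compact_cball continuous_on_vec_lambda continuous_on_quad_form)
  qed (use conv in \<open>auto simp: P_def\<close>)
  have pair_lin: "pairing \<alpha> (($) v) = (\<chi> i. w i * \<alpha> $ i) \<bullet> v" for \<alpha> v
    by (simp add: inner_vec_def mult_ac)
  have Q: "convex Q" "closed Q"
  proof -
    have eq: "{v :: real^'i. 0 \<le> v $ i} = {v. axis i 1 \<bullet> v \<ge> 0}" for i
      by (simp add: inner_axis')
    show "convex Q" unfolding Q_def eq pair_lin
      by (intro convex_Int convex_INT convex_halfspace_ge)
    show "closed Q" unfolding Q_def eq pair_lin
      by (intro closed_Int closed_INT ballI closed_halfspace_ge)
  qed
  have "P \<inter> Q = {}"
  proof (rule ccontr)
    assume "P \<inter> Q \<noteq> {}"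
    then obtain x where x: "norm x \<le> 1" "(\<chi> i. quad_form (A i) x) \<in> Q" by (auto simp: P_def)
    then have ge: "s \<le> quad_form (weighted \<alpha>) x" if "\<alpha> \<in> \<A>" for \<alpha>
      using that by (simp add: Q_def quad_form_weighted_matrix)
    have x0: "x \<noteq> 0"
      using ge multipliers_nonempty s(1) by (auto simp: quad_form_def)
    \<comment> \<open>Stretching \<open>x\<close> to unit length can only increase the nonnegative
      forms, so all of them are still at least \<open>s\<close> at \<open>u\<close>. A multiplier
      nearly optimal at \<open>u\<close>, within half the gap between \<open>s\<close> and the mean
      sum, then gives a contradiction.\<close>
    define u where "u = (1 / norm x) *\<^sub>R x"
    have u: "norm u = 1" "x = norm x *\<^sub>R u" using x0 by (auto simp: u_def)
    have ge': "s \<le> quad_form (weighted \<alpha>) u" if "\<alpha> \<in> \<A>" for \<alpha>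
    proof -
      have "quad_form (weighted \<alpha>) x = (norm x)\<^sup>2 * quad_form (weighted \<alpha>) u"
        by (subst u(2)) (rule quad_form_scaleR)
      also have "\<dots> \<le> 1 * quad_form (weighted \<alpha>) u"
        using x(1) quad_form_weighted_nonneg[OF that]
        by (intro mult_right_mono) (simp_all add: abs_square_le_1)
      finally show ?thesis using ge[OF that] by simp
    qed
    define e where "e = (s - mean_sum K G p w A u) / 2"
    have "0 < e" using s(2)[OF u(1)] by (simp add: e_def)
    then obtain \<alpha> where \<alpha>: "\<alpha> \<in> \<A>"
      "pairing \<alpha> (\<lambda>i. quad_form (A i) u) \<le> means (\<lambda>i. quad_form (A i) u) + e"
      using pairing_approx_means[of "\<lambda>i. quad_form (A i) u", OF quad_form_A_nonneg] by blast
    then have "s \<le> mean_sum K G p w A u + e"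
      using ge'[OF \<alpha>(1)] by (simp add: quad_form_weighted_matrix mean_sum_def)
    then show False using \<open>0 < e\<close> by (simp add: e_def field_simps)
  qed
  then obtain b c where b: "\<And>v. v \<in> P \<Longrightarrow> b \<bullet> v < c" "\<And>v. v \<in> Q \<Longrightarrow> c < b \<bullet> v"
    using separating_hyperplane_compact_closed[OF P Q] by blast
  have 0: "(\<chi> i. quad_form (A i) 0) = (0 :: real^'i)"
    by (simp add: quad_form_def vec_eq_iff)
  have "0 \<in> P" unfolding P_def by (rule image_eqI[of _ _ 0]) (simp_all add: 0)
  then have c: "0 < c" using b(1)[of 0] by simp
  \<comment> \<open>The constant vector \<open>s\<close> lies in \<open>Q\<close>, each of the at
    least one groups having mean 1 on the constant 1.\<close>
  have ones: "s \<le> pairing \<alpha> (\<lambda>_. s)" if "\<alpha> \<in> \<A>" for \<alpha>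
  proof -
    have "1 \<le> real K" using cover by (cases K) auto
    also have "real K = means (\<lambda>_. 1)"
      by (simp add: prob_weights.power_mean_const_1[OF prob_weights_group])
    also have "\<dots> \<le> pairing \<alpha> (\<lambda>_. 1)" using that by (intro means_le_pairing) auto
    finally have "s * 1 \<le> s * pairing \<alpha> (\<lambda>_. 1)" using s(1) by (intro mult_left_mono) auto
    then show ?thesis by (simp add: sum_distrib_left mult_ac)
  qed
  have b_nonneg: "0 \<le> b $ i" for i
  proof (rule ccontr)
    assume "\<not> 0 \<le> b $ i"
    then have bi: "b $ i < 0" by simp
    define v0 :: "real^'i" where "v0 = (\<chi> _. s)"
    \<comment> \<open>\<open>Q\<close> is closed under increasing a coordinate. With
      \<open>b $ i < 0\<close>, going this far along axis \<open>i\<close> would bring the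
      functional down to \<open>c\<close> or below.\<close>
    define t where "t = max 0 ((b \<bullet> v0 - c) / (- b $ i))"
    have "v0 + t *\<^sub>R axis i 1 \<in> Q"
    proof -
      have ge: "s \<le> (v0 + t *\<^sub>R axis i 1) $ j" for j
        by (simp add: v0_def t_def axis_def)
      have "s \<le> pairing \<alpha> (($) (v0 + t *\<^sub>R axis i 1))" if \<alpha>: "\<alpha> \<in> \<A>" for \<alpha>
      proof -
        have "pairing \<alpha> (\<lambda>_. s) \<le> pairing \<alpha> (($) (v0 + t *\<^sub>R axis i 1))"
          using ge multiplier_nonneg[OF \<alpha>] weights_pos
          by (intro sum_mono mult_left_mono) (auto simp: less_imp_le)
        then show ?thesis using ones[OF \<alpha>] by simp
      qed
      moreover have "0 \<le> (v0 + t *\<^sub>R axis i 1) $ j" for j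
        using ge[of j] s(1) by linarith
      ultimately show ?thesis unfolding Q_def by blast
    qed
    then have "c < b \<bullet> (v0 + t *\<^sub>R axis i 1)" by (rule b(2))
    also have "\<dots> = b \<bullet> v0 + t * b $ i" by (simp add: inner_add_right inner_axis)
    finally have "(b \<bullet> v0 - c) / (- b $ i) > t"
      using bi by (subst pos_less_divide_eq) (auto simp: algebra_simps)
    then show False by (simp add: t_def)
  qed
  \<comment> \<open>Compactness of \<open>P\<close> leaves a margin below \<open>c\<close>, which
    pays for adding \<open>d\<close> to every coefficient. Strict positivity is needed to apply the
    equality case of the reverse Hoelder inequality.\<close>
  obtain d where d: "0 < d" "\<And>v. v \<in> P \<Longrightarrow> b \<bullet> v + d * (\<Sum>i\<in>UNIV. v $ i) < c"
  proof -
    have "continuous_on P (\<lambda>v. b \<bullet> v)" by (intro continuous_intros)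
    then obtain v1 where v1: "v1 \<in> P" "\<And>v. v \<in> P \<Longrightarrow> b \<bullet> v \<le> b \<bullet> v1"
      using continuous_attains_sup[OF P(2,3)] by blast
    have "continuous_on P (\<lambda>v. \<Sum>i\<in>UNIV. v $ i)" by (intro continuous_intros)
    then obtain v2 where v2: "v2 \<in> P" "\<And>v. v \<in> P \<Longrightarrow> (\<Sum>i\<in>UNIV. v $ i) \<le> (\<Sum>i\<in>UNIV. v2 $ i)"
      using continuous_attains_sup[OF P(2,3)] by blast
    define r where "r = (\<Sum>i\<in>UNIV. v2 $ i)"
    have r: "0 \<le> r" using v2(2)[OF \<open>0 \<in> P\<close>] by (simp add: r_def)
    have c1: "b \<bullet> v1 < c" using b(1) v1(1) .
    define d where "d = (c - b \<bullet> v1) / (r + 1)"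
    have d: "0 < d" "d * r < c - b \<bullet> v1"
      using c1 r by (auto simp: d_def field_simps)
    have "b \<bullet> v + d * (\<Sum>i\<in>UNIV. v $ i) < c" if "v \<in> P" for v
    proof -
      have "d * (\<Sum>i\<in>UNIV. v $ i) \<le> d * r"
        using v2(2)[OF that] d by (simp add: r_def)
      then show ?thesis using v1(2)[OF that] d by linarith
    qed
    then show ?thesis using that d(1) by blast
  qed
  \<comment> \<open>Division by \<open>w i\<close> absorbs the weights, so that \<open>g\<close>
    acts through the weighted pairing.\<close>
  define g where "g i = (b $ i + d) / w i" for i
  have g: "0 < g i" for i
    using b_nonneg[of i] d(1) weights_pos[of i] by (simp add: g_def)
  have wg: "(\<Sum>i\<in>UNIV. w i * (g i * v $ i)) = b \<bullet> v + d * (\<Sum>i\<in>UNIV. v $ i)" for v :: "real^'i"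
  proof -
    have "w i * (g i * v $ i) = b $ i * v $ i + d * v $ i" for i
      using weights_pos[of i] by (simp add: g_def field_simps)
    then show ?thesis by (simp add: inner_vec_def sum.distrib sum_distrib_left)
  qed
  define m where "m k = power_mean (dual_exponent (p k)) w (G k) g" for k
  have m: "0 < m k" if "k \<in> {1..K}" for k
    unfolding m_def using prob_weights_group[OF that] g by (intro prob_weights.power_mean_pos)
  have cm: "c \<le> s * m k" if k: "k \<in> {1..K}" for k
  proof -
    interpret prob_weights "G k" w using k by (rule prob_weights_group)
    obtain y where y: "\<And>i. i \<in> G k \<Longrightarrow> 0 < y i" "power_mean (p k) w (G k) y = 1"
        "(\<Sum>i\<in>G k. w i * (g i * y i)) = m k"
      using reverse_holder_equality[OF exponents[OF k], of g] g unfolding m_def by blast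
    \<comment> \<open>The test point for group \<open>k\<close>: the equality case scaled by
      \<open>s\<close> and extended by zero. It lies in \<open>Q\<close> because every multiplier
      already pairs to at least \<open>s\<close> with it on \<open>G k\<close>, and \<open>g\<close>
      pairs to exactly \<open>s * m k\<close>.\<close>
    define v :: "real^'i" where "v = (\<chi> i. if i \<in> G k then s * y i else 0)"
    have restr: "(\<Sum>i\<in>UNIV. w i * (h i * v $ i)) = s * (\<Sum>i\<in>G k. w i * (h i * y i))" for h
    proof -
      have "(\<Sum>i\<in>UNIV. w i * (h i * v $ i)) = (\<Sum>i\<in>G k. w i * (h i * (s * y i)))"
        by (rule sum.mono_neutral_cong_right) (auto simp: v_def)
      then show ?thesis by (simp add: sum_distrib_left mult_ac)
    qed
    have "s \<le> pairing \<alpha> (($) v)" if "\<alpha> \<in> \<A>" for \<alpha>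
    proof -
      have "1 \<le> (\<Sum>i\<in>G k. w i * (\<alpha> $ i * y i))"
        using reverse_holder[OF exponents[OF k], of y "($) \<alpha>"] y(1,2) group_multiplier[OF that k]
        by (simp add: less_imp_le)
      then show ?thesis unfolding restr using s(1) by simp
    qed
    moreover have "0 \<le> v $ i" for i
      using y(1)[of i] s(1) by (auto simp: v_def intro!: mult_nonneg_nonneg)
    ultimately have "v \<in> Q" unfolding Q_def by blast
    then have "c < b \<bullet> v" by (rule b(2))
    also have "\<dots> \<le> b \<bullet> v + d * (\<Sum>i\<in>UNIV. v $ i)"
      using d(1) \<open>\<And>i. 0 \<le> v $ i\<close> by (simp add: sum_nonneg)
    also have "\<dots> = s * m k" using restr[of g] wg[of v] y(3) by simp
    finally show ?thesis by simp
  qed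
  have mean_1: "power_mean (dual_exponent (p k)) w (G k) (\<lambda>i. 1 / m k * g i) = 1" if k: "k \<in> {1..K}" for k
    using prob_weights.power_mean_scale[OF prob_weights_group[OF k], of "1 / m k" g] m[OF k] g
    by (simp add: m_def less_imp_le)
  obtain \<alpha> where \<alpha>: "\<alpha> \<in> \<A>" "\<And>k i. k \<in> {1..K} \<Longrightarrow> i \<in> G k \<Longrightarrow> \<alpha> $ i = 1 / m k * g i"
    by (rule multipliers_glue[of "\<lambda>k i. 1 / m k * g i"]) (use m g mean_1 in \<open>simp_all add: less_imp_le\<close>)
  \<comment> \<open>One factor \<open>s / c\<close> serves all groups, although \<open>g\<close> was
    normalised by a different \<open>m k\<close> in each. Since \<open>g\<close> pairs to less than
    \<open>c\<close> on \<open>P\<close>, \<open>\<alpha>\<close> pairs to at most \<open>s\<close>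
    there.\<close>
  have \<alpha>_le: "\<alpha> $ i \<le> s / c * g i" for i
  proof -
    obtain k where k: "k \<in> {1..K}" "i \<in> G k" using cover by blast
    have "1 / m k \<le> s / c" using cm[OF k(1)] m[OF k(1)] c by (simp add: field_simps)
    then show ?thesis unfolding \<alpha>(2)[OF k] using g[of i] by (intro mult_right_mono) auto
  qed
  obtain x where x: "norm x = 1" "quad_form (weighted \<alpha>) x = lambda_max (weighted \<alpha>)"
    using lambda_max_attained[OF sym_weighted] .
  define v :: "real^'i" where "v = (\<chi> i. quad_form (A i) x)"
  have v: "v \<in> P" unfolding P_def v_def using x(1) by (intro imageI) simp
  have "lambda_max (weighted \<alpha>) = (\<Sum>i\<in>UNIV. w i * (\<alpha> $ i * v $ i))"
    using x(2) by (simp add: quad_form_weighted_matrix v_def)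
  also have "\<dots> \<le> (\<Sum>i\<in>UNIV. w i * ((s / c * g i) * v $ i))"
    using weights_pos \<alpha>_le quad_form_A_nonneg
    by (intro sum_mono mult_left_mono mult_right_mono) (auto simp: v_def less_imp_le)
  also have "\<dots> = s / c * (\<Sum>i\<in>UNIV. w i * (g i * v $ i))"
    by (simp add: sum_distrib_left mult_ac)
  also have "\<dots> \<le> s / c * c"
    using d(2)[OF v] s(1) c by (intro mult_left_mono) (auto simp: wg)
  finally show ?thesis using that[OF \<alpha>(1)] c by simp
qed

lemma SUP_mean_sum:
  assumes "ext_convex (lower_envelope A (mat 1))"
  shows "(SUP x\<in>{x. norm x = 1}. mean_sum K G p w A x) = (INF \<alpha>\<in>\<A>. lambda_max (weighted \<alpha>))"
proof (rule antisym)
  define s where "s = (SUP x\<in>{x. norm x = 1}. mean_sum K G p w A x)"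
  \<comment> \<open>Any single multiplier bounds the mean sum on the sphere, so the real supremum is
    meaningful.\<close>
  obtain \<alpha>0 where "\<alpha>0 \<in> \<A>" using multipliers_nonempty by blast
  then have bdd: "bdd_above (mean_sum K G p w A ` {x. norm x = 1})"
    using mean_sum_le_lambda_max by (intro bdd_aboveI2) auto
  have s: "mean_sum K G p w A x \<le> s" if "norm x = 1" for x
    unfolding s_def using that bdd by (intro cSUP_upper) auto
  have s0: "0 \<le> s"
    using s mean_sum_nonneg unit_vectors_nonempty by (metis (mono_tags) empty_Collect_eq order_trans)
  show "s \<le> (INF \<alpha>\<in>\<A>. lambda_max (weighted \<alpha>))"
    unfolding s_def using mean_sum_le_lambda_max
    by (intro cINF_greatest[OF multipliers_nonempty] cSUP_least[OF unit_vectors_nonempty]) auto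
  have "0 \<le> lambda_max (weighted \<alpha>)" if "\<alpha> \<in> \<A>" for \<alpha>
    using lambda_max_attained[OF sym_weighted] quad_form_weighted_nonneg[OF that] by metis
  then have bdd': "bdd_below ((\<lambda>\<alpha>. lambda_max (weighted \<alpha>)) ` \<A>)"
    by (intro bdd_belowI2)
  show "(INF \<alpha>\<in>\<A>. lambda_max (weighted \<alpha>)) \<le> s"
  proof (rule field_le_epsilon)
    fix e :: real assume e: "0 < e"
    \<comment> \<open>Adding \<open>e\<close> makes the bound strict and, with
      \<open>0 \<le> s\<close>, positive, as the separation argument requires.\<close>
    have "mean_sum K G p w A x < s + e" if "norm x = 1" for x
      using s[OF that] e by linarith
    then obtain \<alpha> where \<alpha>: "\<alpha> \<in> \<A>" "lambda_max (weighted \<alpha>) \<le> s + e"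
      using multiplier_above_sup[OF convex_unit_ball_image[OF assms], of "s + e"] s0 e by auto
    have "(INF \<alpha>\<in>\<A>. lambda_max (weighted \<alpha>)) \<le> lambda_max (weighted \<alpha>)"
      using bdd' \<alpha>(1) by (intro cINF_lower)
    then show "(INF \<alpha>\<in>\<A>. lambda_max (weighted \<alpha>)) \<le> s + e" using \<alpha>(2) by simp
  qed
qed

end

theorem corollary4p2:
  fixes K :: nat
    and G :: "nat \<Rightarrow> 'i::finite set"
    and p :: "nat \<Rightarrow> ereal"
    and w :: "'i \<Rightarrow> real"
    and A :: "'i \<Rightarrow> real^'n^'n"
  assumes disjoint: "disjoint_family_on G {1..K}"
    and cover: "(\<Union>k\<in>{1..K}. G k) = UNIV"
    and exponents: "\<And>k. k \<in> {1..K} \<Longrightarrow> p k < 1"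
    and weights_pos: "\<And>i. 0 < w i"
    and weights_sum: "\<And>k. k \<in> {1..K} \<Longrightarrow> (\<Sum>i\<in>G k. w i) = 1"
    and A_psd: "\<And>i. psd_matrix (A i)"
    and A_nonzero: "\<And>i. A i \<noteq> 0"
  shows "(INF x\<in>{x. norm x = 1}. mean_sum K G p w A x)
           = (INF \<alpha>\<in>multipliers K G p w. lambda_min (weighted_matrix w A \<alpha>))
       \<and> (ext_convex (lower_envelope A (mat 1)) \<longrightarrow>
         (SUP x\<in>{x. norm x = 1}. mean_sum K G p w A x)
           = (INF \<alpha>\<in>multipliers K G p w. lambda_max (weighted_matrix w A \<alpha>)))"
proof -
  interpret grouped_forms K G p w A
    using assms by unfold_locales
  show ?thesis using INF_mean_sum SUP_mean_sum by blast
qed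

end
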